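(* Let $\mathscr{E}=\{E_1|H_1,\ldots,E_n|H_n\}$ be a family of $n$ conditional events, with all previsions involved coherently assessed. For each $1\le k\le n$ and each subset $\{i_1,\ldots,i_h\}\subseteq\{1,\ldots,k\}$, with $\{i_{h+1},\ldots,i_k\}=\{1,\ldots,k\}\setminus\{i_1,\ldots,i_h\}$, let \[ \mathscr{C}_{i_1\cdots i_h\overline{i_{h+1}}\cdots\overline{i_k}}=(E_{i_1}|H_{i_1})\wedge\cdots\wedge(E_{i_h}|H_{i_h})\wedge(\overline{E}_{i_{h+1}}|H_{i_{h+1}})\wedge\cdots\wedge(\overline{E}_{i_k}|H_{i_k}). \] Then, for each $1\le k\le n$, \[ \sum_{\{i_1,\ldots,i_h\}\subseteq\{1,\ldots,k\}}\mathscr{C}_{i_1\cdots i_h\overline{i_{h+1}}\cdots\overline{i_k}}=1, \qquad \mathscr{C}_{i_1\cdots i_h\overline{i_{h+1}}\cdots\overline{i_k}}\ge 0\quad\forall\,\{i_1,\ldots,i_h\}\subseteq\{1,\ldots,k\}. \] Equivalently, the sum can be written $\sum_{(1^*,\ldots,k^* )\in\{1,\overline{1}\}\times\cdots\times\{k,\overline{k}\}}\mathscr{C}_{1^*\cdots k^*}=1$, where $\mathscr{C}_{1^*\cdots k^*}=\bigwedge_{i=1}^k(E_i^*|H_i)$ with $E_i^*=E_i$ if $i^*=i$ and $E_i^*=\overline{E}_i$ if $i^*=\overline{i}$.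
   Context: Events. Events are elements of a Boolean algebra with top $\Omega$ (sure event) and bottom $\emptyset$ (impossible event); one may take subsets of a set $\Omega$. An event is identified with its $0/1$ indicator; $EF$ or $E\wedge F$ is conjunction, $E\vee F$ disjunction, $\overline{E}$ negation. Conditional random quantities. Given an event $H\neq\emptyset$, a random quantity $X$ (a real-valued function on $\Omega$ with finitely many values on $H$) and an assessed real number $\mu=\mathbb{P}(X|H)$ (the conditional prevision), the conditional random quantity $X|H$ is $XH+\mu\overline{H}$ (value $X$ if $H$ is true, $\mu$ if $H$ is false). For a conditional event $E|H$ with $P(E|H)=x$, its indicator (same symbol) is $E|H=EH+x\overline{H}$; it is true, false or void when $EH$, $\overline{E}H$ or $\overline{H}$ is true, respectively. Coherence. A prevision assessment on a family of conditional random quantities is coherent if for every finite subfamily $X_1|H_1,\ldots,X_m|H_m$ with assessed previsions $\mu_1,\ldots,\mu_m$ and all real $s_1,\ldots,s_m$, the random gain $G=\sum_{i=1}^m s_iH_i(X_i-\mu_i)$, restricted to $H_1\vee\cdots\vee H_m$, satisfies $\min G\le 0\le\max G$. Conjunction. For a finite family $(A_i|K_i)_{i\in T}$ of conditional events, the conjunctions $\mathscr{C}_S=\bigwedge_{i\in S}(A_i|K_i)$, $\emptyset\ne S\subseteq T$, with assessed previsions $x_S=\mathbb{P}(\mathscr{C}_S)$, are defined recursively on $|S|$ by \[ \mathscr{C}_S=\Big[\bigwedge_{i\in S}A_iK_i+\sum_{\emptyset\neq R\subsetneq S}x_R\Big(\bigwedge_{i\in R}\overline{K}_i\Big)\wedge\Big(\bigwedge_{i\in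 S\setminus R}A_iK_i\Big)\Big]\Big|\Big(\bigvee_{i\in S}K_i\Big), \] i.e. $\mathscr{C}_S$ has value $1$ if all $A_iK_i$ ($i\in S$) are true; $0$ if some $\overline{A}_iK_i$ is true; $x_R$ if exactly the conditional events with index in $R$ are void and the others are true ($\emptyset\ne R\subsetneq S$); $x_S$ if all $K_i$, $i\in S$, are false. For $S=\{i\}$, $\mathscr{C}_S=A_i|K_i$. Standing assumption. The previsions assessed for all conditional events $E_i|H_i$, $\overline{E}_i|H_i$ and all the conjunctions and sub-conjunctions of them involved form a coherent assessment. Equalities and inequalities between conditional random quantities mean that they hold in all cases (as functions on $\Omega$). *)

theory Defs
  imports Complex_Main "HOL-Library.Indicator_Function" "HOL-Library.FuncSet"
begin

text \<open>
  Events are subsets of the sample space, which is the universe of the type variable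
  \<^typ>\<open>'a\<close>.  A conditional random quantity is given by an unconditional one, a conditioning
  event and its assessed prevision.
\<close>

definition cond_rq :: "('a \<Rightarrow> real) \<Rightarrow> 'a set \<Rightarrow> real \<Rightarrow> 'a \<Rightarrow> real" where
  "cond_rq X H \<mu> \<omega> = X \<omega> * indicator H \<omega> + \<mu> * indicator (- H) \<omega>"

definition gain ::
  "'j set \<Rightarrow> ('j \<Rightarrow> real) \<Rightarrow> ('j \<Rightarrow> 'a \<Rightarrow> real) \<Rightarrow> ('j \<Rightarrow> 'a set) \<Rightarrow> ('j \<Rightarrow> real) \<Rightarrow> 'a \<Rightarrow> real" where
  "gain F s X H \<mu> \<omega> = (\<Sum>j\<in>F. s j * indicator (H j) \<omega> * (X j \<omega> - \<mu> j))"

text \<open>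
  \<^const>\<open>Min\<close> and \<^const>\<open>Max\<close> are meaningful here only if the conditioning events are nonempty
  and every \<open>X j\<close> takes finitely many values on \<open>H j\<close>.  The random quantities to which the
  definition is applied below are finitely valued, see \<open>finite_range_conj_rq\<close>.
\<close>

definition coherent ::
  "'j set \<Rightarrow> ('j \<Rightarrow> 'a \<Rightarrow> real) \<Rightarrow> ('j \<Rightarrow> 'a set) \<Rightarrow> ('j \<Rightarrow> real) \<Rightarrow> bool" where
  "coherent J X H \<mu> \<longleftrightarrow>
     (\<forall>F s. finite F \<and> F \<noteq> {} \<and> F \<subseteq> J \<longrightarrow>
        Min (gain F s X H \<mu> ` (\<Union>j\<in>F. H j)) \<le> 0 \<and>
        0 \<le> Max (gain F s X H \<mu> ` (\<Union>j\<in>F. H j)))"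

text \<open>
  Conjunctions of a family of conditional events \<open>A i | K i\<close>.  The assessment \<open>x\<close> gives the
  prevision \<open>x S\<close> of the conjunction over every index set \<open>S\<close>.  The recursion on the
  cardinality of \<open>S\<close> only concerns these previsions, so it disappears once \<open>x\<close> is given:
  the conditioned quantity mentions \<open>x R\<close> for nonempty proper subsets \<open>R\<close> of \<open>S\<close> only.
\<close>

definition conj_rq ::
  "('i \<Rightarrow> 'a set) \<Rightarrow> ('i \<Rightarrow> 'a set) \<Rightarrow> ('i set \<Rightarrow> real) \<Rightarrow> 'i set \<Rightarrow> 'a \<Rightarrow> real" where
  "conj_rq A K x S \<omega> =
     indicator (\<Inter>i\<in>S. A i \<inter> K i) \<omega> +
     (\<Sum>R | R \<noteq> {} \<and> R \<subset> S. x R * indicator ((\<Inter>i\<in>R. - K i) \<inter> (\<Inter>i\<in>S - R. A i \<inter> K i)) \<omega>)"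

definition conj_cond :: "('i \<Rightarrow> 'a set) \<Rightarrow> 'i set \<Rightarrow> 'a set" where
  "conj_cond K S = (\<Union>i\<in>S. K i)"

definition conjunction ::
  "('i \<Rightarrow> 'a set) \<Rightarrow> ('i \<Rightarrow> 'a set) \<Rightarrow> ('i set \<Rightarrow> real) \<Rightarrow> 'i set \<Rightarrow> 'a \<Rightarrow> real" where
  "conjunction A K x S = cond_rq (conj_rq A K x S) (conj_cond K S) (x S)"

lemma finite_range_conj_rq:
  assumes "finite S"
  shows "finite (range (conj_rq A K x S))"
proof -
  let ?D = "{R. R \<noteq> {} \<and> R \<subset> S}"
  let ?f = "\<lambda>(a, B). of_bool a + (\<Sum>R\<in>?D. x R * of_bool (R \<in> B)) :: real"
  have fin: "finite ?D"
    by (rule finite_subset[of _ "Pow S"]) (use assms in auto)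
  have "range (conj_rq A K x S) \<subseteq> ?f ` (UNIV \<times> Pow ?D)"
  proof
    fix y assume "y \<in> range (conj_rq A K x S)"
    then obtain \<omega> where y: "y = conj_rq A K x S \<omega>" by blast
    let ?B = "{R \<in> ?D. \<omega> \<in> (\<Inter>i\<in>R. - K i) \<inter> (\<Inter>i\<in>S - R. A i \<inter> K i)}"
    have "y = ?f (\<omega> \<in> (\<Inter>i\<in>S. A i \<inter> K i), ?B)"
      unfolding y conj_rq_def indicator_def prod.case
      by (intro arg_cong2[where f = "(+)"] refl sum.cong) auto
    then show "y \<in> ?f ` (UNIV \<times> Pow ?D)" by blast
  qed
  then show ?thesis by (rule finite_subset) (use fin in auto)
qed

lemma conjunction_true:
  assumes "S \<noteq> {}" "\<And>i. i \<in> S \<Longrightarrow> \<omega> \<in> A i \<inter> K i"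
  shows "conjunction A K x S \<omega> = 1"
proof -
  have "(\<Sum>R | R \<noteq> {} \<and> R \<subset> S. x R * indicator ((\<Inter>i\<in>R. - K i) \<inter> (\<Inter>i\<in>S - R. A i \<inter> K i)) \<omega>) = 0"
    by (rule sum.neutral) (use assms in \<open>fastforce simp: indicator_def\<close>)
  then show ?thesis
    using assms by (auto simp: conjunction_def cond_rq_def conj_rq_def conj_cond_def indicator_def)
qed

lemma conjunction_false:
  assumes "i \<in> S" "\<omega> \<in> K i - A i"
  shows "conjunction A K x S \<omega> = 0"
proof -
  have "(\<Sum>R | R \<noteq> {} \<and> R \<subset> S. x R * indicator ((\<Inter>i\<in>R. - K i) \<inter> (\<Inter>i\<in>S - R. A i \<inter> K i)) \<omega>) = 0"
    by (rule sum.neutral) (use assms in \<open>fastforce simp: indicator_def\<close>)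
  then show ?thesis
    using assms by (auto simp: conjunction_def cond_rq_def conj_rq_def conj_cond_def indicator_def)
qed

lemma conjunction_partially_void:
  assumes "finite S" "R \<noteq> {}" "R \<subset> S"
    and "\<And>i. i \<in> R \<Longrightarrow> \<omega> \<notin> K i" "\<And>i. i \<in> S - R \<Longrightarrow> \<omega> \<in> A i \<inter> K i"
  shows "conjunction A K x S \<omega> = x R"
proof -
  have fin: "finite {R. R \<noteq> {} \<and> R \<subset> S}"
    by (rule finite_subset[of _ "Pow S"]) (use assms(1) in auto)
  have iff: "(\<omega> \<in> (\<Inter>i\<in>Q. - K i) \<inter> (\<Inter>i\<in>S - Q. A i \<inter> K i)) \<longleftrightarrow> Q = R" if "Q \<subset> S" for Q
    using that assms(3-5) by blast
  have "(\<Sum>Q | Q \<noteq> {} \<and> Q \<subset> S. x Q * indicator ((\<Inter>i\<in>Q. - K i) \<inter> (\<Inter>i\<in>S - Q. A i \<inter> K i)) \<omega>)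
      = (\<Sum>Q | Q \<noteq> {} \<and> Q \<subset> S. if Q = R then x Q else 0)"
    by (rule sum.cong) (use iff in \<open>auto simp: indicator_def\<close>)
  also have "\<dots> = x R" using fin assms(2,3) by simp
  finally have "(\<Sum>Q | Q \<noteq> {} \<and> Q \<subset> S. x Q * indicator ((\<Inter>i\<in>Q. - K i) \<inter> (\<Inter>i\<in>S - Q. A i \<inter> K i)) \<omega>) = x R" .
  moreover have "\<omega> \<notin> (\<Inter>i\<in>S. A i \<inter> K i)" "\<omega> \<in> (\<Union>i\<in>S. K i)"
    using assms(2-5) by blast+
  moreover have "S \<noteq> {}" using assms(3) by blast
  ultimately show ?thesis
    by (simp add: conjunction_def cond_rq_def conj_rq_def conj_cond_def indicator_def)
qed

lemma conjunction_void:
  assumes "\<And>i. i \<in> S \<Longrightarrow> \<omega> \<notin> K i"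
  shows "conjunction A K x S \<omega> = x S"
  using assms by (auto simp: conjunction_def cond_rq_def conj_cond_def indicator_def)

text \<open>
  The conditional events \<open>E i | H i\<close> and \<open>- E i | H i\<close> are indexed by \<open>(i, True)\<close> and
  \<open>(i, False)\<close>.  A choice of signs on \<open>{1..k}\<close> then determines a set of indices.
\<close>

definition lit_event :: "(nat \<Rightarrow> 'a set) \<Rightarrow> nat \<times> bool \<Rightarrow> 'a set" where
  "lit_event E l = (if snd l then E (fst l) else - E (fst l))"

definition lit_cond :: "(nat \<Rightarrow> 'a set) \<Rightarrow> nat \<times> bool \<Rightarrow> 'a set" where
  "lit_cond H l = H (fst l)"

definition literals :: "nat \<Rightarrow> (nat \<Rightarrow> bool) \<Rightarrow> (nat \<times> bool) set" where
  "literals k \<sigma> = (\<lambda>i. (i, \<sigma> i)) ` {1..k}"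

abbreviation constituent ::
  "(nat \<Rightarrow> 'a set) \<Rightarrow> (nat \<Rightarrow> 'a set) \<Rightarrow> ((nat \<times> bool) set \<Rightarrow> real) \<Rightarrow>
   nat \<Rightarrow> (nat \<Rightarrow> bool) \<Rightarrow> 'a \<Rightarrow> real" where
  "constituent E H x k \<sigma> \<equiv> conjunction (lit_event E) (lit_cond H) x (literals k \<sigma>)"

text \<open>
  The index sets of all \<open>constituent E H x k \<sigma>\<close>, \<open>k \<le> n\<close>, and of all their sub-conjunctions;
  the singletons are the conditional events themselves.  No conjunction containing both
  \<open>E i | H i\<close> and \<open>- E i | H i\<close> is among them, so such conjunctions need no assessment.
\<close>

definition involved :: "nat \<Rightarrow> (nat \<times> bool) set set" where
  "involved n = {S. S \<noteq> {} \<and> (\<exists>k\<in>{1..n}. \<exists>\<sigma>. S \<subseteq> literals k \<sigma>)}"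

definition coherently_assessed ::
  "nat \<Rightarrow> (nat \<Rightarrow> 'a set) \<Rightarrow> (nat \<Rightarrow> 'a set) \<Rightarrow> ((nat \<times> bool) set \<Rightarrow> real) \<Rightarrow> bool" where
  "coherently_assessed n E H x \<longleftrightarrow>
     coherent (involved n) (conj_rq (lit_event E) (lit_cond H) x) (conj_cond (lit_cond H)) x"

end

theory Submission
  imports Defs
begin

text \<open>
  Fix an outcome \<open>\<omega>\<close> and let \<open>V\<close> be the set of those \<open>i\<close> in \<open>T\<close> for which \<open>E i | H i\<close> is void
  at \<open>\<omega>\<close>.  A conjunction of signed conditional events over \<open>T\<close> vanishes at \<open>\<omega>\<close> unless its signs
  outside \<open>V\<close> are the ones realised by \<open>\<omega>\<close>, and in that case its value is the prevision of its
  restriction to \<open>V\<close>, where the empty conjunction counts as \<open>1\<close> (\<open>conjunction_value\<close>).  Summing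
  over all signs therefore leaves the sum of the previsions of the conjunctions over \<open>V\<close>
  (\<open>sum_signed_conjunctions\<close>), so the random quantities add up to \<open>1\<close> as soon as the
  previsions do, for every index set.

  The previsions do so by induction on the index set \<open>T\<close> (\<open>sum_signed_previsions\<close>).
  The conjunctions over \<open>T\<close> have the same conditioning event, the union of the \<open>H i\<close>.
  Where it holds, \<open>V\<close> is a proper subset of \<open>T\<close>, so by the induction hypothesis
  the conditioned quantities add up to \<open>1\<close>.  Betting one unit on each of
  them thus has a constant gain, \<open>1\<close> minus the sum of the previsions, and coherence makes it
  zero.  Nonnegativity follows in the same manner: the values of a conjunction on its
  conditioning event are \<open>0\<close>, \<open>1\<close> or previsions of smaller conjunctions, and coherence does not
  permit a negative prevision for a nonnegative quantity.
\<close>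

section \<open>Consequences of coherence\<close>

text \<open>
  A unit bet on \<open>X j\<close> has gain \<open>X j - \<mu> j\<close> on \<open>H j\<close>; with \<open>\<mu> j\<close> negative, its minimum would be
  positive.  Finiteness of the range makes this minimum an attained value.
\<close>

lemma coherent_prevision_nonneg:
  assumes coh: "coherent J X H \<mu>" and j: "j \<in> J" "H j \<noteq> {}"
    and fin: "finite (range (X j))"
    and nonneg: "\<And>\<omega>. \<omega> \<in> H j \<Longrightarrow> X j \<omega> \<ge> 0"
  shows "\<mu> j \<ge> 0"
proof -
  let ?g = "gain {j} (\<lambda>_. 1) X H \<mu>"
  have g: "?g \<omega> = X j \<omega> - \<mu> j" if "\<omega> \<in> H j" for \<omega>
    using that by (simp add: gain_def)
  have "?g ` H j \<subseteq> (\<lambda>y. y - \<mu> j) ` range (X j)"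
    using g by auto
  then have "finite (?g ` H j)"
    using fin finite_surj by blast
  moreover have "?g ` H j \<noteq> {}"
    using j by simp
  ultimately have "Min (?g ` H j) \<in> ?g ` H j"
    by (rule Min_in)
  moreover have "Min (?g ` H j) \<le> 0"
    using coh[unfolded coherent_def, rule_format, of "{j}" "\<lambda>_. 1"] j by simp
  ultimately obtain \<omega> where "\<omega> \<in> H j" "?g \<omega> \<le> 0"
    by force
  then show ?thesis
    using g[of \<omega>] nonneg[of \<omega>] by simp
qed

text \<open>
  Unit bets on quantities with a common conditioning event are all in force or all called off.
  Their joint gain where they are in force is therefore a constant, at once
  its minimum and its maximum, hence \<open>0\<close>.
\<close>

lemma coherent_sum_previsions_eq_const:
  assumes coh: "coherent J X H \<mu>" and F: "finite F" "F \<noteq> {}" "F \<subseteq> J"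
    and cond: "\<And>j. j \<in> F \<Longrightarrow> H j = K" and K: "K \<noteq> {}"
    and const: "\<And>\<omega>. \<omega> \<in> K \<Longrightarrow> (\<Sum>j\<in>F. X j \<omega>) = c"
  shows "(\<Sum>j\<in>F. \<mu> j) = c"
proof -
  let ?g = "gain F (\<lambda>_. 1) X H \<mu>"
  have "?g \<omega> = c - (\<Sum>j\<in>F. \<mu> j)" if "\<omega> \<in> K" for \<omega>
  proof -
    have "?g \<omega> = (\<Sum>j\<in>F. X j \<omega> - \<mu> j)"
      unfolding gain_def by (rule sum.cong) (simp_all add: that cond)
    then show ?thesis
      using const[OF that] by (simp add: sum_subtractf)
  qed
  then have "?g ` K = (\<lambda>_. c - (\<Sum>j\<in>F. \<mu> j)) ` K"
    by (rule image_cong[OF refl])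
  then have "?g ` K = {c - (\<Sum>j\<in>F. \<mu> j)}"
    using K by (simp only: image_constant_conv if_False)
  moreover have "(\<Union>j\<in>F. H j) = K"
    using F(2) by (simp add: cond)
  moreover have "Min (?g ` (\<Union>j\<in>F. H j)) \<le> 0" "0 \<le> Max (?g ` (\<Union>j\<in>F. H j))"
    using coh F unfolding coherent_def by blast+
  ultimately show ?thesis
    by simp
qed

section \<open>Values of a conjunction\<close>

text \<open>The empty conjunction is the sure event, of prevision \<open>1\<close>.\<close>

definition prevision1 :: "('i set \<Rightarrow> real) \<Rightarrow> 'i set \<Rightarrow> real" where
  "prevision1 x S = (if S = {} then 1 else x S)"

text \<open>
  With the convention for the empty conjunction, the cases \<open>true\<close>, \<open>partially void\<close> and
  \<open>void\<close> become a single one.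
\<close>

lemma conjunction_value:
  assumes "finite S" "S \<noteq> {}"
  shows "conjunction A K x S \<omega> =
    (if \<exists>i\<in>S. \<omega> \<in> K i - A i then 0 else prevision1 x {i\<in>S. \<omega> \<notin> K i})"
proof (cases "\<exists>i\<in>S. \<omega> \<in> K i - A i")
  case True
  then obtain i where "i \<in> S" "\<omega> \<in> K i - A i"
    by blast
  then have "conjunction A K x S \<omega> = 0"
    using conjunction_false[of i S \<omega> K A x] by blast
  then show ?thesis
    by (simp only: if_P[OF True])
next
  case False
  let ?V = "{i\<in>S. \<omega> \<notin> K i}"
  have true: "\<omega> \<in> A i \<inter> K i" if "i \<in> S - ?V" for i
    using False that by blast
  consider "?V = {}" | "?V \<noteq> {}" "?V \<subset> S" | "?V = S"
    by blast
  then have "conjunction A K x S \<omega> = prevision1 x ?V"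
  proof cases
    case 1
    then have "conjunction A K x S \<omega> = 1"
      using assms(2) true by (intro conjunction_true) auto
    then show ?thesis
      by (simp only: 1 prevision1_def if_True refl)
  next
    case 2
    then have "conjunction A K x S \<omega> = x ?V"
    proof (rule conjunction_partially_void[OF assms(1)])
      show "\<omega> \<notin> K i" if "i \<in> ?V" for i
        using that by blast
    qed (rule true)
    then show ?thesis
      by (simp only: prevision1_def if_not_P[OF 2(1)])
  next
    case 3
    then have "conjunction A K x S \<omega> = x S"
      by (intro conjunction_void) blast
    then show ?thesis
      by (simp only: 3 prevision1_def if_not_P[OF assms(2)])
  qed
  then show ?thesis
    by (simp only: if_not_P[OF False])
qed

lemma conj_rq_eq_conjunction:
  assumes "\<omega> \<in> conj_cond K S"
  shows "conj_rq A K x S \<omega> = conjunction A K x S \<omega>"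
  using assms by (simp add: conjunction_def cond_rq_def)

section \<open>Signed index sets\<close>

text \<open>
  Restricting a conjunction to its void part leads to arbitrary finite index sets \<open>T\<close> instead
  of initial segments; \<open>I\<close> collects the indices with positive sign.
\<close>

definition signed :: "nat set \<Rightarrow> nat set \<Rightarrow> (nat \<times> bool) set" where
  "signed T I = (\<lambda>i. (i, i \<in> I)) ` T"

lemma literals_eq_signed: "literals k \<sigma> = signed {1..k} {i \<in> {1..k}. \<sigma> i}"
  unfolding literals_def signed_def by (rule image_cong) auto

lemma inj_on_signed: "inj_on (signed T) (Pow T)"
proof (rule inj_onI)
  fix I J assume "I \<in> Pow T" "J \<in> Pow T" "signed T I = signed T J"
  moreover have "I = {i. (i, True) \<in> signed T I}" if "I \<in> Pow T" for I
    using that by (auto simp: signed_def)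
  ultimately show "I = J"
    by metis
qed

lemma signed_eq_empty_iff: "signed T I = {} \<longleftrightarrow> T = {}"
  by (simp add: signed_def)

lemma signed_involved:
  assumes "T \<noteq> {}" "T \<subseteq> {1..n}"
  shows "signed T I \<in> involved n"
proof -
  have "n \<in> {1..n}"
    using assms by force
  moreover have "signed T I \<subseteq> literals n (\<lambda>i. i \<in> I)"
    using assms(2) by (auto simp: signed_def literals_def)
  ultimately show ?thesis
    using assms(1) by (auto simp: involved_def signed_def)
qed

lemma conj_cond_signed: "conj_cond (lit_cond H) (signed T I) = (\<Union>i\<in>T. H i)"
  by (auto simp: conj_cond_def lit_cond_def signed_def)

lemma signed_conjunction_value:
  assumes "finite T" "T \<noteq> {}"
  shows "conjunction (lit_event E) (lit_cond H) x (signed T I) \<omega> =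
    (if \<exists>i\<in>T. \<omega> \<in> H i \<and> (i \<in> I) \<noteq> (\<omega> \<in> E i) then 0
     else prevision1 x (signed {i\<in>T. \<omega> \<notin> H i} I))"
proof -
  have void: "{l \<in> signed T I. \<omega> \<notin> lit_cond H l} = signed {i\<in>T. \<omega> \<notin> H i} I"
    by (auto simp: signed_def lit_cond_def)
  have false: "(\<exists>l\<in>signed T I. \<omega> \<in> lit_cond H l - lit_event E l) \<longleftrightarrow>
      (\<exists>i\<in>T. \<omega> \<in> H i \<and> (i \<in> I) \<noteq> (\<omega> \<in> E i))"
    by (auto simp: signed_def lit_cond_def lit_event_def)
  have "finite (signed T I)" "signed T I \<noteq> {}"
    using assms by (auto simp: signed_def)
  from conjunction_value[OF this, of "lit_event E" "lit_cond H" x \<omega>] show ?thesis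
    unfolding void false .
qed

text \<open>
  The signs outside the void part \<open>V\<close> are prescribed by \<open>\<omega>\<close>, those on \<open>V\<close> are free; hence the
  nonzero terms correspond to the subsets of \<open>V\<close>.
\<close>

lemma sum_signed_conjunctions:
  assumes "finite T" "T \<noteq> {}"
  shows "(\<Sum>I\<in>Pow T. conjunction (lit_event E) (lit_cond H) x (signed T I) \<omega>) =
    (\<Sum>J\<in>Pow {i\<in>T. \<omega> \<notin> H i}. prevision1 x (signed {i\<in>T. \<omega> \<notin> H i} J))"
proof -
  let ?V = "{i\<in>T. \<omega> \<notin> H i}"
  define P where "P = {i\<in>T. \<omega> \<in> H i \<and> \<omega> \<in> E i}"
  let ?c = "\<lambda>I. conjunction (lit_event E) (lit_cond H) x (signed T I) \<omega>"
  have zero: "?c I = 0" if I: "I \<in> Pow T - (\<lambda>J. J \<union> P) ` Pow ?V" for I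
  proof -
    have "\<exists>i\<in>T. \<omega> \<in> H i \<and> (i \<in> I) \<noteq> (\<omega> \<in> E i)"
    proof (rule ccontr)
      assume "\<not> ?thesis"
      then have "I = (I \<inter> ?V) \<union> P"
        using I by (auto simp: P_def)
      then show False
        using I by blast
    qed
    then show ?thesis
      unfolding signed_conjunction_value[OF assms] by (rule if_P)
  qed
  have val: "?c (J \<union> P) = prevision1 x (signed ?V J)" if J: "J \<in> Pow ?V" for J
  proof -
    have "signed ?V (J \<union> P) = signed ?V J"
      unfolding signed_def P_def by (rule image_cong) auto
    moreover have "\<not> (\<exists>i\<in>T. \<omega> \<in> H i \<and> (i \<in> J \<union> P) \<noteq> (\<omega> \<in> E i))"
      using J by (auto simp: P_def)
    ultimately show ?thesis
      unfolding signed_conjunction_value[OF assms] by (simp only: if_False)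
  qed
  have inj: "inj_on (\<lambda>J. J \<union> P) (Pow ?V)"
    unfolding P_def by (rule inj_onI) blast
  have "(\<Sum>I\<in>Pow T. ?c I) = (\<Sum>I\<in>(\<lambda>J. J \<union> P) ` Pow ?V. ?c I)"
    by (rule sum.mono_neutral_right) (use assms zero in \<open>auto simp: P_def\<close>)
  also have "\<dots> = (\<Sum>J\<in>Pow ?V. prevision1 x (signed ?V J))"
    using val by (simp add: sum.reindex[OF inj])
  finally show ?thesis .
qed

section \<open>Previsions of signed conjunctions\<close>

lemma signed_prevision_nonneg:
  assumes nonempty: "\<forall>i\<in>{1..n}. H i \<noteq> {}" and coh: "coherently_assessed n E H x"
    and T: "T \<subseteq> {1..n}"
  shows "prevision1 x (signed T I) \<ge> 0"
proof -
  have "finite T"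
    using T finite_subset by blast
  then show ?thesis
    using T
  proof (induction T rule: finite_psubset_induct)
    case (psubset T)
    show ?case
    proof (cases "T = {}")
      case False
      let ?S = "signed T I"
      have "conj_rq (lit_event E) (lit_cond H) x ?S \<omega> \<ge> 0"
        if \<omega>: "\<omega> \<in> conj_cond (lit_cond H) ?S" for \<omega>
      proof -
        have "{i\<in>T. \<omega> \<notin> H i} \<subset> T"
          using \<omega> by (auto simp: conj_cond_signed)
        then have "prevision1 x (signed {i\<in>T. \<omega> \<notin> H i} I) \<ge> 0"
          using psubset by blast
        then show ?thesis
          unfolding conj_rq_eq_conjunction[OF \<omega>] signed_conjunction_value[OF psubset(1) False]
          by simp
      qed
      moreover have "conj_cond (lit_cond H) ?S \<noteq> {}"
        using nonempty False psubset.prems by (auto simp: conj_cond_signed)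
      moreover have "finite ?S"
        using psubset(1) by (simp add: signed_def)
      ultimately have "x ?S \<ge> 0"
        by (intro coherent_prevision_nonneg[OF coh[unfolded coherently_assessed_def]]
            signed_involved[OF False psubset.prems] finite_range_conj_rq)
      then show ?thesis
        by (simp add: prevision1_def)
    qed (simp add: prevision1_def signed_def)
  qed
qed

lemma sum_signed_previsions:
  assumes nonempty: "\<forall>i\<in>{1..n}. H i \<noteq> {}" and coh: "coherently_assessed n E H x"
    and T: "T \<subseteq> {1..n}"
  shows "(\<Sum>I\<in>Pow T. prevision1 x (signed T I)) = 1"
proof -
  have "finite T"
    using T finite_subset by blast
  then show ?thesis
    using T
  proof (induction T rule: finite_psubset_induct)
    case (psubset T)
    show ?case
    proof (cases "T = {}")
      case False
      let ?F = "signed T ` Pow T" and ?K = "\<Union>i\<in>T. H i"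
      let ?X = "conj_rq (lit_event E) (lit_cond H) x"
      have sum1: "(\<Sum>S\<in>?F. ?X S \<omega>) = 1" if \<omega>: "\<omega> \<in> ?K" for \<omega>
      proof -
        have "(\<Sum>S\<in>?F. ?X S \<omega>) =
            (\<Sum>I\<in>Pow T. conjunction (lit_event E) (lit_cond H) x (signed T I) \<omega>)"
          using \<omega> by (simp add: sum.reindex[OF inj_on_signed] conj_rq_eq_conjunction
              conj_cond_signed)
        also have "\<dots> = (\<Sum>J\<in>Pow {i\<in>T. \<omega> \<notin> H i}. prevision1 x (signed {i\<in>T. \<omega> \<notin> H i} J))"
          by (rule sum_signed_conjunctions[OF psubset(1) False])
        also have "\<dots> = 1"
        proof (rule psubset.IH)
          show "{i\<in>T. \<omega> \<notin> H i} \<subset> T"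
            using \<omega> by auto
          show "{i\<in>T. \<omega> \<notin> H i} \<subseteq> {1..n}"
            using psubset.prems by auto
        qed
        finally show ?thesis .
      qed
      have "(\<Sum>S\<in>?F. x S) = 1"
      proof (rule coherent_sum_previsions_eq_const[OF coh[unfolded coherently_assessed_def]])
        show "finite ?F" "?F \<noteq> {}"
          using psubset(1) by auto
        show "?F \<subseteq> involved n"
          using signed_involved[OF False psubset.prems] by blast
        show "?K \<noteq> {}"
          using nonempty False psubset.prems by auto
      qed (use sum1 in \<open>auto simp: conj_cond_signed\<close>)
      then show ?thesis
        using False by (simp add: sum.reindex[OF inj_on_signed] prevision1_def signed_eq_empty_iff)
    qed (simp add: prevision1_def signed_def)
  qed
qed

theorem theorem10:
  fixes E H :: "nat \<Rightarrow> 'a set"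
    and x :: "(nat \<times> bool) set \<Rightarrow> real"
    and n k :: nat
  assumes nonempty: "\<forall>i\<in>{1..n}. H i \<noteq> {}"
    and coherent: "coherently_assessed n E H x"
    and k: "1 \<le> k" "k \<le> n"
  shows "(\<forall>\<omega>. (\<Sum>I\<in>Pow {1..k}. constituent E H x k (\<lambda>i. i \<in> I) \<omega>) = 1) \<and>
         (\<forall>\<omega>. (\<Sum>\<sigma>\<in>{1..k} \<rightarrow>\<^sub>E UNIV. constituent E H x k \<sigma> \<omega>) = 1) \<and>
         (\<forall>I\<in>Pow {1..k}. \<forall>\<omega>. constituent E H x k (\<lambda>i. i \<in> I) \<omega> \<ge> 0)"
proof -
  let ?T = "{1..k}"
  have T: "finite ?T" "?T \<noteq> {}"
    using k by auto
  have lit: "literals k (\<lambda>i. i \<in> I) = signed ?T I" for I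
    by (simp add: literals_def signed_def)
  have V: "{i\<in>?T. \<omega> \<notin> H i} \<subseteq> {1..n}" for \<omega>
    using k by auto
  have sum1: "(\<Sum>I\<in>Pow ?T. conjunction (lit_event E) (lit_cond H) x (signed ?T I) \<omega>) = 1" for \<omega>
    unfolding sum_signed_conjunctions[OF T] by (rule sum_signed_previsions[OF nonempty coherent V])
  have bij: "bij_betw (\<lambda>\<sigma>. {i\<in>?T. \<sigma> i}) (?T \<rightarrow>\<^sub>E UNIV) (Pow ?T)"
    by (rule bij_betw_byWitness[where f' = "\<lambda>I. restrict (\<lambda>i. i \<in> I) ?T"])
      (auto simp: PiE_def extensional_def restrict_def fun_eq_iff)
  have "(\<Sum>\<sigma>\<in>?T \<rightarrow>\<^sub>E UNIV. constituent E H x k \<sigma> \<omega>) = 1" for \<omega>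
    using sum.reindex_bij_betw[OF bij,
        of "\<lambda>I. conjunction (lit_event E) (lit_cond H) x (signed ?T I) \<omega>"] sum1
    unfolding literals_eq_signed by simp
  moreover have "constituent E H x k (\<lambda>i. i \<in> I) \<omega> \<ge> 0" for I \<omega>
    unfolding lit signed_conjunction_value[OF T]
    using signed_prevision_nonneg[OF nonempty coherent V] by auto
  ultimately show ?thesis
    using sum1 unfolding lit by blast
qed

end
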